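(* Let $n\ge 6$ be an integer. If there exists a trichord cycle in $\mathbb{Z}_n$ that is zigzag (i.e. presents the chromatic class $T_2$ in zigzag), then $3\mid n$.
   Context: For $2\le k\le n-2$ let $T_k$ be the transposition class of the set $\{0,1,k\}\subset\mathbb{Z}_n$, i.e. all sets $\{x,x+1,x+k\}$, $x\in\mathbb{Z}_n$. A trichord cycle in $\mathbb{Z}_n$ is a cyclic word $c_0c_1\cdots c_{m-1}$ over $\mathbb{Z}_n$ with $m=n-3$ (letters may repeat) such that the $m$ windows $W_i=\{c_i,c_{i+1},c_{i+2}\}$ (indices mod $m$) are three-element sets and each class $T_k$, $2\le k\le n-2$, contains exactly one of the windows. The chromatic window is the unique $W_i$ belonging to $T_2$. The cycle is scalar if the ordered triple $(c_i,c_{i+1},c_{i+2})$ of the chromatic window is a translate of $(0,1,2)$ or of $(2,1,0)$, and zigzag otherwise. *)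

theory Defs
  imports Main
begin

text \<open>The group of integers modulo \<open>n\<close> is represented by the residues \<open>{0..<int n}\<close>.\<close>

abbreviation Zn :: "nat \<Rightarrow> int set" where
  "Zn n \<equiv> {0..<int n}"

definition translate :: "nat \<Rightarrow> int \<Rightarrow> int \<Rightarrow> int" where
  "translate n x s = (s + x) mod int n"

definition transposition_class :: "nat \<Rightarrow> int set \<Rightarrow> int set set" where
  "transposition_class n S = {translate n x ` S | x. x \<in> Zn n}"

definition trichord_class :: "nat \<Rightarrow> nat \<Rightarrow> int set set" where
  "trichord_class n k = transposition_class n {0, 1, int k}"

text \<open>A cyclic word is given by a list, read from an arbitrary starting letter with cyclic
  indices.\<close>

definition cyc_nth :: "'a list \<Rightarrow> nat \<Rightarrow> 'a" where
  "cyc_nth c i = c ! (i mod length c)"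

definition ordered_window :: "'a list \<Rightarrow> nat \<Rightarrow> 'a list" where
  "ordered_window c i = [cyc_nth c i, cyc_nth c (i + 1), cyc_nth c (i + 2)]"

definition window :: "'a list \<Rightarrow> nat \<Rightarrow> 'a set" where
  "window c i = {cyc_nth c i, cyc_nth c (i + 1), cyc_nth c (i + 2)}"

definition trichord_cycle :: "nat \<Rightarrow> int list \<Rightarrow> bool" where
  "trichord_cycle n c \<longleftrightarrow>
     length c = n - 3 \<and> set c \<subseteq> Zn n \<and>
     (\<forall>i<length c. card (window c i) = 3) \<and>
     (\<forall>k\<in>{2..n-2}. \<exists>!i. i < length c \<and> window c i \<in> trichord_class n k)"

text \<open>The position of the chromatic window; meaningful for trichord cycles only.\<close>

definition chromatic_index :: "nat \<Rightarrow> int list \<Rightarrow> nat" where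
  "chromatic_index n c = (THE i. i < length c \<and> window c i \<in> trichord_class n 2)"

definition scalar :: "nat \<Rightarrow> int list \<Rightarrow> bool" where
  "scalar n c \<longleftrightarrow>
     (\<exists>x\<in>Zn n. ordered_window c (chromatic_index n c) = map (translate n x) [0, 1, 2] \<or>
               ordered_window c (chromatic_index n c) = map (translate n x) [2, 1, 0])"

definition zigzag :: "nat \<Rightarrow> int list \<Rightarrow> bool" where
  "zigzag n c \<longleftrightarrow> \<not> scalar n c"

end

theory Submission
  imports Defs
begin

text \<open>Weight the steps \<open>c\<^sub>i\<^sub>+\<^sub>1 - c\<^sub>i\<close> of the cycle by the function \<open>G\<close> on \<open>\<int>\<^sub>n\<close> with \<open>G(1) = 1\<close>,
  \<open>G(-1) = -1\<close> and \<open>G(j) = n + j\<close> for \<open>2 \<le> j \<le> n - 2\<close>, which is odd modulo 3. A window with steps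
  \<open>d, d'\<close> contributes \<open>G(d) - G(d')\<close>, and these contributions sum to zero around the cycle.
  For \<open>3 \<le> k \<le> n - 2\<close> we have \<open>G(k) = G(k - 1) + G(1)\<close>, so modulo 3 the contribution of a window in
  \<open>T\<^sub>k\<close> is \<open>-1 - n - k\<close> in whatever order its letters are read. These values sum to zero modulo 3
  over \<open>3 \<le> k \<le> n - 2\<close>, whereas the chromatic window contributes \<open>\<plusminus>n\<close> if it is presented in zigzag.\<close>

definition step :: "nat \<Rightarrow> int list \<Rightarrow> nat \<Rightarrow> int" where
  "step n c i = (cyc_nth c (i + 1) - cyc_nth c i) mod int n"

definition step_weight :: "nat \<Rightarrow> int \<Rightarrow> int" where
  "step_weight n j = (if j = 1 then 1 else if j = int n - 1 then -1 else int n + j)"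

text \<open>On the circle the points 0, 1, k cut off the arcs 1, k - 1, n - k. The first three pairs
  are consecutive arcs in this cyclic order; the other three are the same pairs reversed and
  negated, as in reading a window backwards.\<close>

definition trichord_steps :: "nat \<Rightarrow> nat \<Rightarrow> (int \<times> int) set" where
  "trichord_steps n k =
     {(1, int k - 1), (int k - 1, int n - int k), (int n - int k, 1),
      (int n - 1, int k), (int k, int n + 1 - int k), (int n + 1 - int k, int n - 1)}"

lemma mod_diff_translates:
  "((s + x) mod m - (t + x) mod m) mod m = (s - t) mod (m::int)"
  by (simp add: mod_diff_eq)

text \<open>Translation cancels in differences of letters, so only the six orders of 0, 1, k
  remain.\<close>

lemma steps_of_trichord:
  assumes k: "k \<in> {2..n-2}" and card: "card {a, b, c} = 3"
    and cl: "{a, b, c} \<in> trichord_class n k"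
  shows "((b - a) mod int n, (c - b) mod int n) \<in> trichord_steps n k"
proof -
  define N where "N = int n"
  have kN: "2 \<le> int k" "int k \<le> N - 2" using k by (auto simp: N_def)
  obtain x where "{a, b, c} = translate n x ` {0, 1, int k}"
    using cl by (auto simp: trichord_class_def transposition_class_def)
  then have eq: "{a, b, c} = {(0 + x) mod N, (1 + x) mod N, (int k + x) mod N}"
    by (simp add: translate_def N_def)
  have "a \<noteq> b" "b \<noteq> c" "a \<noteq> c"
    using card by (auto simp: card_insert_if split: if_splits)
  then have perms:
    "(a = p \<and> b = q \<and> c = r) \<or> (a = p \<and> b = r \<and> c = q) \<or> (a = q \<and> b = p \<and> c = r) \<or>
     (a = q \<and> b = r \<and> c = p) \<or> (a = r \<and> b = p \<and> c = q) \<or> (a = r \<and> b = q \<and> c = p)"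
    if "{a, b, c} = {p, q, r}" for p q r
  proof -
    have "a \<in> {p, q, r}" "b \<in> {p, q, r}" "c \<in> {p, q, r}"
      unfolding that[symmetric] by simp_all
    then show ?thesis using \<open>a \<noteq> b\<close> \<open>b \<noteq> c\<close> \<open>a \<noteq> c\<close> by blast
  qed
  have m: "1 mod N = 1" "(-1) mod N = N - 1" "int k mod N = int k" "(- int k) mod N = N - int k"
    "(int k - 1) mod N = int k - 1" "(1 - int k) mod N = N + 1 - int k"
    using kN by (auto intro!: int_mod_pos_eq[of _ N 0] int_mod_pos_eq[of _ N "-1"])
  show ?thesis
    using perms[OF eq] unfolding N_def[symmetric]
    by (elim disjE conjE)
      (simp_all only: mod_diff_translates diff_0 diff_0_right m, simp_all add: trichord_steps_def N_def)
qed

lemma trichord_steps_inj: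
  assumes "k \<in> {2..n-2}" "l \<in> {2..n-2}" "p \<in> trichord_steps n k" "p \<in> trichord_steps n l"
  shows "k = l"
  using assms by (auto simp: trichord_steps_def)

text \<open>The weights of the three arcs sum to 3n, and three numbers with sum 0 modulo 3 have
  equal cyclic differences. Backward readings give the same value because the weight is odd modulo
  3.\<close>

lemma weight_of_trichord:
  assumes "k \<in> {3..n-2}" "(d, e) \<in> trichord_steps n k"
  shows "3 dvd step_weight n d - step_weight n e + (1 + int n + int k)"
proof -
  \<comment> \<open>The bounds on k keep k, k - 1, n - k and n + 1 - k away from the exceptional
    steps 1 and n - 1; for k = 2 this fails.\<close>
  have w: "step_weight n 1 = 1" "step_weight n (int n - 1) = -1"
    "step_weight n (int k) = int n + int k" "step_weight n (int k - 1) = int n + int k - 1"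
    "step_weight n (int n - int k) = 2 * int n - int k"
    "step_weight n (int n + 1 - int k) = 2 * int n + 1 - int k"
    using assms(1) by (simp_all add: step_weight_def) linarith+
  from assms(2) consider "d = 1" "e = int k - 1" | "d = int k - 1" "e = int n - int k"
    | "d = int n - int k" "e = 1" | "d = int n - 1" "e = int k"
    | "d = int k" "e = int n + 1 - int k" | "d = int n + 1 - int k" "e = int n - 1"
    unfolding trichord_steps_def by blast
  then show ?thesis
    by cases (simp_all only: w, presburger+)
qed

text \<open>The four remaining pairs combine one step 1 or -1 with one step 2 or -2 and contribute 3
  - 2n, 2n - 3 or, up to sign, n + 3.\<close>

lemma weight_of_zigzag:
  assumes "n \<ge> 6" "(d, e) \<in> trichord_steps n 2" "(d, e) \<noteq> (1, 1)" "(d, e) \<noteq> (int n - 1, int n - 1)"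
    and "3 dvd step_weight n d - step_weight n e"
  shows "3 dvd n"
proof -
  have "3 dvd int n"
    using assms by (auto simp: trichord_steps_def step_weight_def) presburger+
  then show ?thesis by presburger
qed

lemma translate_of_steps:
  assumes "a \<in> Zn n" "b \<in> Zn n" "c \<in> Zn n" "(b - a) mod int n = 1 mod int n" "(c - b) mod int n = 1 mod int n"
  shows "[a, b, c] = map (translate n a) [0, 1, 2]"
proof -
  have "b mod int n = (1 + a) mod int n"
    using mod_add_cong[OF assms(4) refl, of a] by simp
  moreover have "c mod int n = (1 + b) mod int n"
    using mod_add_cong[OF assms(5) refl, of b] by simp
  ultimately show ?thesis
    using assms(1-3) by (simp add: translate_def mod_simps)
qed

lemma sum_step_weight_diff:
  "(\<Sum>i<length c. step_weight n (step n c i) - step_weight n (step n c (Suc i))) = 0"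
proof -
  have "step n c (length c) = step n c 0"
    by (simp add: step_def cyc_nth_def mod_Suc)
  then show ?thesis
    using sum_lessThan_telescope'[of "\<lambda>i. step_weight n (step n c i)" "length c"] by simp
qed

lemma double_sum_class_weights:
  assumes "n \<ge> 4"
  shows "2 * (\<Sum>k\<in>{2..n-2}. 1 + int n + int k) = (int n - 3) * (3 * int n + 2)"
proof -
  \<comment> \<open>Since n occurs both in the summand and in the upper bound, \<open>q\<close> is
    separated so that the induction changes the bound alone.\<close>
  have gen: "2 * (\<Sum>k\<in>{2..m+2}. q + int k) = (int m + 1) * (2 * q + int m + 4)" for m :: nat and q
    by (induction m) (simp_all add: algebra_simps)
  obtain m where m: "n = m + 4" using assms le_Suc_ex by (metis add.commute)
  then have "n - 2 = m + 2" by simp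
  then show ?thesis
    unfolding \<open>n - 2 = m + 2\<close> gen by (simp add: m algebra_simps)
qed

text \<open>A step pair determines its class, so distinct classes sit at distinct positions. There
  are n - 3 of each, hence the classes exhaust all windows.\<close>

lemma trichord_cycle_windows:
  assumes "trichord_cycle n c"
  obtains f where "bij_betw f {2..n-2} {..<length c}"
    and "\<And>k. k \<in> {2..n-2} \<Longrightarrow> window c (f k) \<in> trichord_class n k"
    and "\<And>k. k \<in> {2..n-2} \<Longrightarrow> (step n c (f k), step n c (Suc (f k))) \<in> trichord_steps n k"
proof -
  have ex: "\<forall>k\<in>{2..n-2}. \<exists>i. i < length c \<and> window c i \<in> trichord_class n k"
    using assms unfolding trichord_cycle_def by blast
  obtain f where f: "\<And>k. k \<in> {2..n-2} \<Longrightarrow> f k < length c"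
    and cl: "\<And>k. k \<in> {2..n-2} \<Longrightarrow> window c (f k) \<in> trichord_class n k"
    using bchoice[OF ex] by blast
  have st: "(step n c (f k), step n c (Suc (f k))) \<in> trichord_steps n k" if "k \<in> {2..n-2}" for k
  proof -
    have "card (window c (f k)) = 3"
      using assms f[OF that] by (simp add: trichord_cycle_def)
    then show ?thesis
      using steps_of_trichord[OF that] cl[OF that] by (simp add: window_def step_def)
  qed
  have "inj_on f {2..n-2}"
    using st trichord_steps_inj by (metis inj_onI)
  moreover have "f ` {2..n-2} \<subseteq> {..<length c}" using f by auto
  moreover have "card {2..n-2} = card {..<length c}"
    using assms by (simp add: trichord_cycle_def)
  ultimately have "bij_betw f {2..n-2} {..<length c}"
    by (metis bij_betw_def card_image card_subset_eq finite_lessThan)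
  with cl st that show thesis by blast
qed

lemma zigzag_chromatic_steps:
  assumes n: "n \<ge> 6" and c: "trichord_cycle n c" "zigzag n c"
    and i: "i < length c" "window c i \<in> trichord_class n 2"
  shows "(step n c i, step n c (Suc i)) \<noteq> (1, 1)"
    and "(step n c i, step n c (Suc i)) \<noteq> (int n - 1, int n - 1)"
proof -
  have "2 \<in> {2..n-2}" using n by simp
  then have "\<exists>!i. i < length c \<and> window c i \<in> trichord_class n 2"
    using c(1) unfolding trichord_cycle_def by blast
  then have chrom: "chromatic_index n c = i"
    unfolding chromatic_index_def using i by (intro the1_equality) auto
  have Z: "cyc_nth c j \<in> Zn n" for j
  proof -
    have "j mod length c < length c"
      using i(1) mod_less_divisor[of "length c" j] by linarith
    then show ?thesis
      using c(1) nth_mem unfolding trichord_cycle_def cyc_nth_def by blast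
  qed
  have ns: "ordered_window c i \<noteq> map (translate n x) [0, 1, 2]"
    "ordered_window c i \<noteq> map (translate n x) [2, 1, 0]" if "x \<in> Zn n" for x
    using c(2) that chrom by (auto simp: zigzag_def scalar_def)
  have "step n c i = 1 mod int n \<Longrightarrow> step n c (Suc i) = 1 mod int n \<Longrightarrow> False"
    using ns(1)[OF Z[of i]] translate_of_steps[OF Z[of i] Z[of "i+1"] Z[of "i+2"]]
    by (simp add: step_def ordered_window_def)
  then show "(step n c i, step n c (Suc i)) \<noteq> (1, 1)"
    using n by auto
  show "(step n c i, step n c (Suc i)) \<noteq> (int n - 1, int n - 1)"
  proof
    \<comment> \<open>Read backwards, two steps -1 become two steps 1, which reduces this case to a
      translate of (0, 1, 2) starting at the last letter.\<close>
    have neg: "(a - b) mod int n = 1 mod int n" if "(b - a) mod int n = int n - 1" for a b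
      using mod_minus_cong[of "b - a" "int n" "int n - 1"] that n
      by (metis diff_add_cancel minus_diff_eq mod_add_self2 mod_mod_trivial)
    assume "(step n c i, step n c (Suc i)) = (int n - 1, int n - 1)"
    then show False
      using ns(2)[OF Z[of "i+2"]] translate_of_steps[OF Z[of "i+2"] Z[of "i+1"] Z[of i]] neg
      by (simp add: step_def ordered_window_def)
  qed
qed

theorem theorem6p1:
  fixes n :: nat
  assumes "n \<ge> 6"
    and "\<exists>c. trichord_cycle n c \<and> zigzag n c"
  shows "3 dvd n"
proof -
  obtain c where c: "trichord_cycle n c" "zigzag n c" using assms(2) by blast
  obtain f where f: "bij_betw f {2..n-2} {..<length c}"
    and cl: "\<And>k. k \<in> {2..n-2} \<Longrightarrow> window c (f k) \<in> trichord_class n k"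
    and st: "\<And>k. k \<in> {2..n-2} \<Longrightarrow> (step n c (f k), step n c (Suc (f k))) \<in> trichord_steps n k"
    using trichord_cycle_windows[OF c(1)] by blast
  define F where "F i = step_weight n (step n c i) - step_weight n (step n c (Suc i))" for i
  define w where "w k = 1 + int n + int k" for k
  have two: "2 \<in> {2..n-2}" and split: "{2..n-2} = insert 2 {3..n-2}" using assms(1) by auto
  have "(\<Sum>k\<in>{2..n-2}. F (f k)) = 0"
    using sum.reindex_bij_betw[OF f, of F] sum_step_weight_diff[of n c] by (simp add: F_def)
  \<comment> \<open>The contributions cancel, so they can be added freely; each class with k at
    least 3 then gives a multiple of 3.\<close>
  then have "sum w {2..n-2} = (\<Sum>k\<in>{2..n-2}. F (f k) + w k)"
    by (simp add: sum.distrib)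
  also have "\<dots> = F (f 2) + w 2 + (\<Sum>k\<in>{3..n-2}. F (f k) + w k)"
    unfolding split by (subst sum.insert) auto
  finally have total: "sum w {2..n-2} = F (f 2) + w 2 + (\<Sum>k\<in>{3..n-2}. F (f k) + w k)" .
  have "3 dvd (\<Sum>k\<in>{3..n-2}. F (f k) + w k)"
  proof (rule dvd_sum)
    fix k assume k: "k \<in> {3..n-2}"
    then show "3 dvd F (f k) + w k"
      using weight_of_trichord[OF k st[of k]] by (simp add: F_def w_def)
  qed
  moreover have "2 * sum w {2..n-2} = 3 * ((int n - 1) * (int n - 2) - 4) + 2 * int n"
    using double_sum_class_weights[of n] assms(1) by (simp add: w_def[abs_def] algebra_simps)
  \<comment> \<open>Modulo 3 the total is n, as 2 is invertible, and so is \<open>w 2\<close> = n +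
    3; this leaves 0 for the chromatic contribution.\<close>
  moreover have "3 dvd x" if "s = x + w 2 + t" "3 dvd t" "2 * s = 3 * q + 2 * int n" for s x t q
    using that unfolding w_def by presburger
  ultimately have "3 dvd F (f 2)"
    using total by blast
  moreover have "f 2 < length c" using bij_betwE[OF f] two by auto
  ultimately show ?thesis
    using weight_of_zigzag[OF assms(1) st[OF two]] zigzag_chromatic_steps[OF assms(1) c _ cl[OF two]]
    by (simp add: F_def)
qed

end
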